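(* Let $(x_k)_{k\ge 0}$, $(d_k)_{k\ge 0}$ be generated by algorithm CPG (see context) applied to $F=f+\psi$ under assumptions A.1, A.2, A.3, with the indices $i_k\in\{1,\dots,N\}$ chosen in an arbitrary way (in particular uniformly at random or cyclically). Then $$F(x_{k+1})\le F(x_k)-\frac{\eta_{\min}}{2}\|d_k\|^2\qquad\text{for all } k\ge 0 .$$
   Context: Setting: $F=f+\psi$ with $f,\psi:\mathbb{R}^n\to\mathbb{R}$, $f$ differentiable, both possibly nonconvex. $U=[U_1,\dots,U_N]\in\mathbb{R}^{n\times n}$ is a column permutation of the identity $I_n$, split into submatrices $U_i\in\mathbb{R}^{n\times n_i}$, $\sum_{i=1}^N n_i=n$. Norms are Euclidean. Assumptions. A.1: there are constants $L_i$ with $\|U_i^T(\nabla f(x+U_ih)-\nabla f(x))\|\le L_i\|h\|$ for all $h\in\mathbb{R}^{n_i}$, $x\in\mathbb{R}^n$, $i=1,\dots,N$. A.2: $\psi$ is twice continuously differentiable. A.3: $F$ attains its minimum, $F^*:=\min_{\mathbb{R}^n} F>-\infty$. $\psi$ is called convex along coordinates if for all $x\in\mathbb{R}^n$ and $i$ the function $d\mapsto\psi(x+U_id)$ is convex on $\mathbb{R}^{n_i}$. Algorithm CPG: fix constants $\eta_i>0$, $i=1,\dots,N$, and set $H_{f,U_i}=\frac{L_i+\eta_i}{2}$ if $\psi$ is convex along coordinates, and $H_{f,U_i}=L_i+\eta_i$ otherwise. Given $x_0\in\mathbb{R}^n$, for $k\ge0$: choose $i_k\in\{1,\dots,N\}$;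 take $$d_k\in\arg\min_{d\in\mathbb{R}^{n_{i_k}}} f(x_k)+\langle U_{i_k}^T\nabla f(x_k),d\rangle+\tfrac{H_{f,U_{i_k}}}{2}\|d\|^2+\psi(x_k+U_{i_k}d)$$ (a global minimizer, assumed to exist); set $x_{k+1}=x_k+U_{i_k}d_k$. Denote $\eta_{\min}=\min_{i=1,\dots,N}\eta_i$. *)

theory Defs
  imports "HOL-Analysis.Analysis"
begin

text \<open>
  The block sizes \<open>n i\<close> vary with the block, so \<open>\<real>\<^sup>m\<close> with \<open>m = n i\<close> cannot be a type
  \<open>real ^ 'm\<close>. It is the set of all \<open>d :: nat \<Rightarrow> real\<close> vanishing outside
  \<open>{..<m}\<close>; its Euclidean norm is \<open>L2_set d {..<m}\<close>.
\<close>

definition coord_space :: "nat \<Rightarrow> (nat \<Rightarrow> real) set" where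
  "coord_space m = {d. \<forall>j\<ge>m. d j = 0}"

definition coord_inner :: "nat \<Rightarrow> (nat \<Rightarrow> real) \<Rightarrow> (nat \<Rightarrow> real) \<Rightarrow> real" where
  "coord_inner m d e = (\<Sum>j<m. d j * e j)"

text \<open>
  An \<open>n \<times> n\<close> matrix \<open>U\<close>, with \<open>n = CARD('n)\<close>, is given by its columns
  \<open>U 0, \<dots>, U (n - 1)\<close>, because splitting it needs an order on the columns. The blocks
  \<open>U\<^sub>1, \<dots>, U\<^sub>N\<close> are consecutive groups of columns, so column \<open>j < n i\<close> of
  \<open>U\<^sub>i\<close> is column \<open>n 1 + \<dots> + n (i - 1) + j\<close> of \<open>U\<close>.
\<close>

definition column_permutation_of_id :: "(nat \<Rightarrow> real ^ 'n) \<Rightarrow> bool" where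
  "column_permutation_of_id U \<longleftrightarrow>
     (\<exists>\<sigma>. bij_betw \<sigma> {..<CARD('n)} (UNIV :: 'n set) \<and>
          (\<forall>j<CARD('n). U j = column (\<sigma> j) (mat 1 :: real ^ 'n ^ 'n)))"

definition block_column :: "(nat \<Rightarrow> real ^ 'n) \<Rightarrow> (nat \<Rightarrow> nat) \<Rightarrow> nat \<Rightarrow> nat \<Rightarrow> real ^ 'n" where
  "block_column U n i j = U ((\<Sum>l=1..<i. n l) + j)"

text \<open>The products \<open>U\<^sub>i d\<close> and \<open>U\<^sub>i\<^sup>T v\<close>.\<close>

definition block_mult :: "(nat \<Rightarrow> real ^ 'n) \<Rightarrow> (nat \<Rightarrow> nat) \<Rightarrow> nat \<Rightarrow> (nat \<Rightarrow> real) \<Rightarrow> real ^ 'n" where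
  "block_mult U n i d = (\<Sum>j<n i. d j *\<^sub>R block_column U n i j)"

definition block_transpose_mult ::
    "(nat \<Rightarrow> real ^ 'n) \<Rightarrow> (nat \<Rightarrow> nat) \<Rightarrow> nat \<Rightarrow> real ^ 'n \<Rightarrow> (nat \<Rightarrow> real)" where
  "block_transpose_mult U n i v = (\<lambda>j. if j < n i then block_column U n i j \<bullet> v else 0)"

definition twice_continuously_differentiable :: "(real ^ 'n \<Rightarrow> real) \<Rightarrow> bool" where
  "twice_continuously_differentiable \<psi> \<longleftrightarrow>
     (\<exists>(G :: real ^ 'n \<Rightarrow> real ^ 'n) (D :: real ^ 'n \<Rightarrow> (real ^ 'n) \<Rightarrow>\<^sub>L (real ^ 'n)).
        (\<forall>x. GDERIV \<psi> x :> G x) \<and>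
        (\<forall>x. (G has_derivative blinfun_apply (D x)) (at x)) \<and>
        continuous_on UNIV D)"

text \<open>The inequality is convexity of \<open>d \<mapsto> \<psi> (x + U\<^sub>i d)\<close>; the library's
  \<open>convex_on\<close> does not apply to functions on \<open>coord_space\<close>, as \<open>nat \<Rightarrow> real\<close>
  is not an instance of \<open>real_vector\<close>.\<close>

definition convex_along_coordinates ::
    "(nat \<Rightarrow> real ^ 'n) \<Rightarrow> (nat \<Rightarrow> nat) \<Rightarrow> nat \<Rightarrow> (real ^ 'n \<Rightarrow> real) \<Rightarrow> bool" where
  "convex_along_coordinates U n N \<psi> \<longleftrightarrow>
     (\<forall>x. \<forall>i\<in>{1..N}. \<forall>d\<in>coord_space (n i). \<forall>e\<in>coord_space (n i). \<forall>t\<in>{0..1}.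
        \<psi> (x + block_mult U n i (\<lambda>j. (1 - t) * d j + t * e j))
          \<le> (1 - t) * \<psi> (x + block_mult U n i d) + t * \<psi> (x + block_mult U n i e))"

definition cpg_H :: "(nat \<Rightarrow> real ^ 'n) \<Rightarrow> (nat \<Rightarrow> nat) \<Rightarrow> nat \<Rightarrow> (real ^ 'n \<Rightarrow> real) \<Rightarrow>
    (nat \<Rightarrow> real) \<Rightarrow> (nat \<Rightarrow> real) \<Rightarrow> nat \<Rightarrow> real" where
  "cpg_H U n N \<psi> L \<eta> i =
     (if convex_along_coordinates U n N \<psi> then (L i + \<eta> i) / 2 else L i + \<eta> i)"

definition cpg_model :: "(nat \<Rightarrow> real ^ 'n) \<Rightarrow> (nat \<Rightarrow> nat) \<Rightarrow> (real ^ 'n \<Rightarrow> real) \<Rightarrow>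
    (real ^ 'n \<Rightarrow> real ^ 'n) \<Rightarrow> (real ^ 'n \<Rightarrow> real) \<Rightarrow> real \<Rightarrow> nat \<Rightarrow> real ^ 'n \<Rightarrow>
    (nat \<Rightarrow> real) \<Rightarrow> real" where
  "cpg_model U n f gradf \<psi> H i x d =
     f x + coord_inner (n i) (block_transpose_mult U n i (gradf x)) d
       + H / 2 * (L2_set d {..<n i})\<^sup>2 + \<psi> (x + block_mult U n i d)"

end

theory Submission
  imports Defs
begin

text \<open>Along the block direction, A.1 bounds the growth of \<open>f\<close> by the block descent lemma with
  curvature \<open>L\<close>. Comparing the model at its minimizer \<open>d\<close> with its value at \<open>0\<close> gains
  \<open>H / 2 * \<parallel>d\<parallel>\<^sup>2\<close>; if \<open>\<psi>\<close> is convex along coordinates, comparing with \<open>t d\<close> and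
  letting \<open>t \<rightarrow> 1\<close> gains twice as much. Both choices of \<open>H\<close> make the gain exceed the
  descent-lemma term \<open>L / 2 * \<parallel>d\<parallel>\<^sup>2\<close> by exactly \<open>\<eta> / 2 * \<parallel>d\<parallel>\<^sup>2\<close>.\<close>

lemma block_mult_scale: "block_mult U n i (\<lambda>j. t * d j) = t *\<^sub>R block_mult U n i d"
  by (simp add: block_mult_def scaleR_sum_right)

lemma coord_space_scale: "d \<in> coord_space m \<Longrightarrow> (\<lambda>j. t * d j) \<in> coord_space m"
  by (simp add: coord_space_def)

lemma coord_inner_scale: "coord_inner m g (\<lambda>j. t * d j) = t * coord_inner m g d"
  by (simp add: coord_inner_def sum_distrib_left algebra_simps)

lemma L2_set_scale: "L2_set (\<lambda>j. t * d j) A = \<bar>t\<bar> * L2_set d A"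
proof -
  have "(\<Sum>j\<in>A. (t * d j)\<^sup>2) = t\<^sup>2 * (\<Sum>j\<in>A. (d j)\<^sup>2)"
    by (simp add: sum_distrib_left power_mult_distrib)
  then show ?thesis
    by (simp add: L2_set_def real_sqrt_mult)
qed

lemma coord_inner_le_L2_set: "coord_inner m d e \<le> L2_set d {..<m} * L2_set e {..<m}"
proof -
  have "coord_inner m d e \<le> (\<Sum>j<m. \<bar>d j\<bar> * \<bar>e j\<bar>)"
    unfolding coord_inner_def by (intro sum_mono) (metis abs_ge_self abs_mult)
  also have "\<dots> \<le> L2_set d {..<m} * L2_set e {..<m}"
    by (rule L2_set_mult_ineq)
  finally show ?thesis .
qed

lemma coord_inner_block_transpose_mult:
  "coord_inner (n i) (block_transpose_mult U n i v) d = block_mult U n i d \<bullet> v"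
  by (simp add: coord_inner_def block_transpose_mult_def block_mult_def inner_sum_left mult.commute)

text \<open>Restrict \<open>f\<close> to the segment from \<open>x\<close> to
  \<open>x + block_mult U n i d\<close> and subtract the claimed quadratic bound. Cauchy-Schwarz and
  \<open>lip\<close> make the derivative of the difference nonpositive, so a monotonicity argument
  replaces the usual integral of the gradient.\<close>

lemma block_descent:
  fixes f :: "real ^ 'n \<Rightarrow> real"
  assumes grad: "\<And>y. GDERIV f y :> gradf y"
    and lip: "\<And>y h. h \<in> coord_space (n i) \<Longrightarrow>
        L2_set (block_transpose_mult U n i (gradf (y + block_mult U n i h) - gradf y)) {..<n i}
          \<le> L * L2_set h {..<n i}"
    and d: "d \<in> coord_space (n i)"
  shows "f (x + block_mult U n i d)
      \<le> f x + coord_inner (n i) (block_transpose_mult U n i (gradf x)) d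
          + L / 2 * (L2_set d {..<n i})\<^sup>2"
proof -
  let ?u = "block_mult U n i d" and ?s = "L2_set d {..<n i}"
  \<comment> \<open>Up to the constant \<open>f x\<close>, \<open>g t\<close> is the value of
    \<open>f\<close> minus its upper bound at step \<open>t * d\<close>; hence
    \<open>g 1 \<le> g 0\<close> is the claim. \<open>g'\<close> is its derivative.\<close>
  define g where "g t = f (x + t *\<^sub>R ?u) - t * (?u \<bullet> gradf x) - L / 2 * t\<^sup>2 * ?s\<^sup>2" for t :: real
  define g' where "g' t = ?u \<bullet> gradf (x + t *\<^sub>R ?u) - ?u \<bullet> gradf x - L * t * ?s\<^sup>2" for t :: real
  have "g 1 \<le> g 0"
  proof (rule DERIV_nonpos_imp_nonincreasing[where f = g])
    fix t :: real
    assume "0 \<le> t" "t \<le> 1"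
    have "((\<lambda>t. f (x + t *\<^sub>R ?u)) has_derivative (\<lambda>h. (h *\<^sub>R ?u) \<bullet> gradf (x + t *\<^sub>R ?u))) (at t)"
      by (rule has_derivative_compose[where f = "\<lambda>t. x + t *\<^sub>R ?u"])
        (use grad in \<open>auto simp: gderiv_def intro!: derivative_eq_intros\<close>)
    then have "((\<lambda>t. f (x + t *\<^sub>R ?u)) has_real_derivative ?u \<bullet> gradf (x + t *\<^sub>R ?u)) (at t)"
      by (simp add: has_field_derivative_def mult.commute[of _ "?u \<bullet> _"])
    then have "(g has_real_derivative g' t) (at t)"
      unfolding g_def g'_def by (auto intro!: derivative_eq_intros)
    moreover have "g' t \<le> 0"
    proof -
      let ?v = "block_transpose_mult U n i (gradf (x + t *\<^sub>R ?u) - gradf x)"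
      have "?u \<bullet> gradf (x + t *\<^sub>R ?u) - ?u \<bullet> gradf x = coord_inner (n i) ?v d"
        by (simp add: coord_inner_block_transpose_mult inner_diff_right)
      also have "\<dots> \<le> L2_set ?v {..<n i} * ?s"
        by (rule coord_inner_le_L2_set)
      \<comment> \<open>\<open>lip\<close> is applied to the scaled step \<open>t * d\<close>, whose
        norm is \<open>t * ?s\<close> because \<open>t\<close> is nonnegative.\<close>
      also have "\<dots> \<le> (L * (t * ?s)) * ?s"
        using lip[OF coord_space_scale[OF d, of t], of x] \<open>0 \<le> t\<close>
        by (intro mult_right_mono) (simp_all add: block_mult_scale L2_set_scale)
      finally show ?thesis
        by (simp add: g'_def power2_eq_square algebra_simps)
    qed
    ultimately show "\<exists>y. (g has_real_derivative y) (at t) \<and> y \<le> 0"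
      by blast
  qed simp
  then show ?thesis
    by (simp add: g_def coord_inner_block_transpose_mult)
qed

lemma cpg_model_decrease:
  assumes "is_arg_min (cpg_model U n f gradf \<psi> H i x) (\<lambda>e. e \<in> coord_space (n i)) d"
  shows "coord_inner (n i) (block_transpose_mult U n i (gradf x)) d
      + H / 2 * (L2_set d {..<n i})\<^sup>2 + \<psi> (x + block_mult U n i d) \<le> \<psi> x"
proof -
  \<comment> \<open>The competitor is the zero step, written as \<open>0 * d j\<close> so that the
    scaling lemmas evaluate the model there.\<close>
  have "(\<lambda>j. 0 * d j) \<in> coord_space (n i)"
    by (simp add: coord_space_def)
  then have "cpg_model U n f gradf \<psi> H i x d \<le> cpg_model U n f gradf \<psi> H i x (\<lambda>j. 0 * d j)"
    using assms unfolding is_arg_min_linorder by blast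
  then show ?thesis
    unfolding cpg_model_def block_mult_scale coord_inner_scale L2_set_scale by simp
qed

text \<open>Against the competitor \<open>t * d\<close>, the quadratic term gains
  \<open>H / 2 * (1 - t\<^sup>2)\<close> times the squared norm, while convexity between
  \<open>0\<close> and \<open>d\<close> makes the change in \<open>\<psi>\<close> at least
  proportional to \<open>1 - t\<close>. Dividing by \<open>1 - t\<close> leaves the coefficient
  \<open>H / 2 * (1 + t)\<close>, which tends to \<open>H\<close> as \<open>t\<close> tends to
  1.\<close>

lemma cpg_model_decrease_convex:
  assumes min: "is_arg_min (cpg_model U n f gradf \<psi> H i x) (\<lambda>e. e \<in> coord_space (n i)) d"
    and conv: "convex_along_coordinates U n N \<psi>" and i: "i \<in> {1..N}"
  shows "coord_inner (n i) (block_transpose_mult U n i (gradf x)) d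
      + H * (L2_set d {..<n i})\<^sup>2 + \<psi> (x + block_mult U n i d) \<le> \<psi> x"
proof -
  let ?u = "block_mult U n i d"
  define s where "s = (L2_set d {..<n i})\<^sup>2"
  define c where "c = coord_inner (n i) (block_transpose_mult U n i (gradf x)) d"
  have d: "d \<in> coord_space (n i)"
    using min by (simp add: is_arg_min_linorder)
  have bound: "c + \<psi> (x + ?u) - \<psi> x + H / 2 * (1 + t) * s \<le> 0" if t: "0 \<le> t" "t < 1" for t
  proof -
    have "cpg_model U n f gradf \<psi> H i x d \<le> cpg_model U n f gradf \<psi> H i x (\<lambda>j. t * d j)"
      using min coord_space_scale[OF d, of t] unfolding is_arg_min_linorder by blast
    then have opt: "c + H / 2 * s + \<psi> (x + ?u) \<le> t * c + H / 2 * (t\<^sup>2 * s) + \<psi> (x + t *\<^sub>R ?u)"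
      unfolding cpg_model_def block_mult_scale coord_inner_scale L2_set_scale
      by (simp add: power_mult_distrib c_def s_def)
    have "(\<lambda>_. 0) \<in> coord_space (n i)"
      by (simp add: coord_space_def)
    moreover have "t \<in> {0..1}"
      using t by simp
    \<comment> \<open>Convexity with endpoints \<open>0\<close> and \<open>d\<close>: the convex
      combination is \<open>t * d\<close>.\<close>
    ultimately have "\<psi> (x + block_mult U n i (\<lambda>j. (1 - t) * 0 + t * d j))
        \<le> (1 - t) * \<psi> (x + block_mult U n i (\<lambda>_. 0)) + t * \<psi> (x + ?u)"
      using conv[unfolded convex_along_coordinates_def, rule_format, OF i _ d, of "\<lambda>_. 0" t x] by simp
    moreover have "block_mult U n i (\<lambda>_. 0) = 0"
      by (simp add: block_mult_def)
    ultimately have "\<psi> (x + t *\<^sub>R ?u) \<le> (1 - t) * \<psi> x + t * \<psi> (x + ?u)"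
      by (simp add: block_mult_scale)
    \<comment> \<open>The common factor comes from
      \<open>1 - t\<^sup>2 = (1 - t) * (1 + t)\<close>.\<close>
    moreover have "(1 - t) * (c + \<psi> (x + ?u) - \<psi> x + H / 2 * (1 + t) * s)
        = (c + H / 2 * s + \<psi> (x + ?u)) - (t * c + H / 2 * (t\<^sup>2 * s))
          - ((1 - t) * \<psi> x + t * \<psi> (x + ?u))"
      by (simp add: field_simps power2_eq_square)
    ultimately have "(1 - t) * (c + \<psi> (x + ?u) - \<psi> x + H / 2 * (1 + t) * s) \<le> 0"
      using opt by linarith
    then show ?thesis
      using t by (simp add: mult_le_0_iff)
  qed
  \<comment> \<open>At \<open>t = 1\<close> the competitor is \<open>d\<close> itself and the
    comparison is void, so the bound there is reached only as a limit from the left.\<close>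
  have "((\<lambda>t. c + \<psi> (x + ?u) - \<psi> x + H / 2 * (1 + t) * s)
      \<longlongrightarrow> c + \<psi> (x + ?u) - \<psi> x + H / 2 * (1 + 1) * s) (at_left 1)"
    by (intro tendsto_intros)
  moreover have "\<forall>\<^sub>F t in at_left (1::real). 0 < t \<and> t < 1"
    using eventually_at_left_real[of 0 "1::real"] by simp
  then have "\<forall>\<^sub>F t in at_left (1::real). c + \<psi> (x + ?u) - \<psi> x + H / 2 * (1 + t) * s \<le> 0"
    by eventually_elim (use bound in simp)
  ultimately have "c + \<psi> (x + ?u) - \<psi> x + H / 2 * (1 + 1) * s \<le> 0"
    by (rule tendsto_upperbound) simp
  then show ?thesis
    by (simp add: c_def s_def)
qed

theorem lemma3p1:
  fixes f \<psi> F :: "real ^ 'n \<Rightarrow> real"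
    and gradf :: "real ^ 'n \<Rightarrow> real ^ 'n"
    and U :: "nat \<Rightarrow> real ^ 'n"
    and n :: "nat \<Rightarrow> nat"
    and N :: nat
    and L \<eta> :: "nat \<Rightarrow> real"
    and x :: "nat \<Rightarrow> real ^ 'n"
    and d :: "nat \<Rightarrow> nat \<Rightarrow> real"
    and i :: "nat \<Rightarrow> nat"
  defines "F \<equiv> (\<lambda>y. f y + \<psi> y)"
  assumes U_perm: "column_permutation_of_id U"
    and block_sizes: "(\<Sum>l=1..N. n l) = CARD('n)"
    and grad: "\<And>y. GDERIV f y :> gradf y"
    and A1: "\<And>l y h. l \<in> {1..N} \<Longrightarrow> h \<in> coord_space (n l) \<Longrightarrow>
        L2_set (block_transpose_mult U n l (gradf (y + block_mult U n l h) - gradf y)) {..<n l}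
          \<le> L l * L2_set h {..<n l}"
    and A2: "twice_continuously_differentiable \<psi>"
    and A3: "\<exists>y. \<forall>z. F y \<le> F z"
    and eta_pos: "\<And>l. l \<in> {1..N} \<Longrightarrow> \<eta> l > 0"
    and index: "\<And>k. i k \<in> {1..N}"
    and subproblem: "\<And>k. is_arg_min
        (cpg_model U n f gradf \<psi> (cpg_H U n N \<psi> L \<eta> (i k)) (i k) (x k))
        (\<lambda>e. e \<in> coord_space (n (i k))) (d k)"
    and update: "\<And>k. x (Suc k) = x k + block_mult U n (i k) (d k)"
  shows "\<forall>k. F (x (Suc k))
      \<le> F (x k) - (MIN l\<in>{1..N}. \<eta> l) / 2 * (L2_set (d k) {..<n (i k)})\<^sup>2"
proof
  fix k
  let ?l = "i k"
  define s where "s = (L2_set (d k) {..<n ?l})\<^sup>2"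
  define c where "c = coord_inner (n ?l) (block_transpose_mult U n ?l (gradf (x k))) (d k)"
  have "d k \<in> coord_space (n ?l)"
    using subproblem[of k] by (simp add: is_arg_min_linorder)
  with grad A1[OF index] have descent: "f (x (Suc k)) \<le> f (x k) + c + L ?l / 2 * s"
    unfolding update c_def s_def by (rule block_descent)
  \<comment> \<open>The two definitions of \<open>cpg_H\<close> meet here: the convex case gains the
    full \<open>H = (L + \<eta>) / 2\<close>, the other case gains half of
    \<open>H = L + \<eta>\<close>.\<close>
  have gain: "c + (L ?l + \<eta> ?l) / 2 * s + \<psi> (x (Suc k)) \<le> \<psi> (x k)"
  proof (cases "convex_along_coordinates U n N \<psi>")
    case True
    then show ?thesis
      using cpg_model_decrease_convex[OF subproblem[of k] True index]
      by (simp add: cpg_H_def c_def s_def update)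
  next
    case False
    then show ?thesis
      using cpg_model_decrease[OF subproblem[of k]] by (simp add: cpg_H_def c_def s_def update)
  qed
  have "(MIN l\<in>{1..N}. \<eta> l) \<le> \<eta> ?l"
    using index[of k] by (intro Min_le) auto
  then have "(MIN l\<in>{1..N}. \<eta> l) / 2 * s \<le> \<eta> ?l / 2 * s"
    by (intro mult_right_mono) (simp_all add: s_def)
  moreover have "(L ?l + \<eta> ?l) / 2 * s = L ?l / 2 * s + \<eta> ?l / 2 * s"
    by (simp add: add_divide_distrib distrib_right)
  ultimately show "F (x (Suc k))
      \<le> F (x k) - (MIN l\<in>{1..N}. \<eta> l) / 2 * (L2_set (d k) {..<n ?l})\<^sup>2"
    using descent gain unfolding F_def s_def[symmetric] by linarith
qed

end
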